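(* Let $c>0$, $r_h>0$, $b>r_h$ and $t_b\ge 0$. For the linear dilaton black hole, whose metric in Kruskal coordinates is $ds^2=-du\,dv+r^2(u,v)(dx^2+dy^2)$ with $r(u,v)=\sqrt{r_h^2-uv}$, the matter entropy per unit area without an island (defined in the context), for radiation regions bounded by the points $b_\mp$, equals $$S_{\rm matter}=\frac c3\log\left[2\sqrt{\frac{b^2-r_h^2}{r_h^2}}\,\cosh\frac{t_b}{r_h}\right].$$ Consequently it grows linearly at late times: $S_{\rm matter}\sim\frac c3\frac{t_b}{r_h}$ as $t_b\to\infty$.
   Context: For a metric $-e^{2\rho(u,v)}du\,dv+r^2(u,v)(dx^2+dy^2)$, the matter entropy per unit area without island is defined by the two-dimensional CFT formula (with central charge $c$) $$S_{\rm matter}=\frac{c}{12}\log\left[\frac{(u_{b_-}-u_{b_+})^2(v_{b_-}-v_{b_+})^2\,e^{2\rho(b_+)}e^{2\rho(b_-)}}{r_h^4}\right],$$ the power of $r_h$ being included to make the argument dimensionless. Here $\rho\equiv0$. With $r^*(r)=\frac{r_h}{2}\log\left(\frac{r^2}{r_h^2}-1\right)$, a point of the right wedge with coordinates $(t,r)$ has $u=-r_he^{-(t-r^* )/r_h}$, $v=r_he^{(t+r^* )/r_h}$, and a point of the left wedge with coordinates $(t,r)$ has both signs flipped: $u=r_he^{-(t-r^* )/r_h}$, $v=-r_he^{(t+r^* )/r_h}$. The point $b_+$ is the right-wedge point with $(t,r)=(t_b,b)$; the point $b_-$ is the left-wedge point with $(t,r)=(-t_b,b)$. *)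

theory Defs
  imports Complex_Main "HOL-Library.Landau_Symbols"
begin

(* Points of the (u, v) plane are pairs.  A record g stands for the metric
   ds^2 = - e^(2 rho) du dv + r^2 (dx^2 + dy^2), written out in line_element. *)
record conformal_metric =
  rho :: "real \<times> real \<Rightarrow> real"
  radius :: "real \<times> real \<Rightarrow> real"

definition line_element ::
  "conformal_metric \<Rightarrow> real \<times> real \<Rightarrow> real \<Rightarrow> real \<Rightarrow> real \<Rightarrow> real \<Rightarrow> real" where
  "line_element g p du dv dx dy =
     - exp (2 * rho g p) * du * dv + (radius g p)\<^sup>2 * (dx\<^sup>2 + dy\<^sup>2)"

definition linear_dilaton_bh :: "real \<Rightarrow> conformal_metric" where
  "linear_dilaton_bh rh =
     \<lparr> rho = (\<lambda>_. 0), radius = (\<lambda>(u, v). sqrt (rh\<^sup>2 - u * v)) \<rparr>"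

definition tortoise :: "real \<Rightarrow> real \<Rightarrow> real" where
  "tortoise rh r = rh / 2 * ln (r\<^sup>2 / rh\<^sup>2 - 1)"

definition right_wedge :: "real \<Rightarrow> real \<Rightarrow> real \<Rightarrow> real \<times> real" where
  "right_wedge rh t r =
     (- rh * exp (- (t - tortoise rh r) / rh), rh * exp ((t + tortoise rh r) / rh))"

definition left_wedge :: "real \<Rightarrow> real \<Rightarrow> real \<Rightarrow> real \<times> real" where
  "left_wedge rh t r =
     (rh * exp (- (t - tortoise rh r) / rh), - rh * exp ((t + tortoise rh r) / rh))"

definition b_plus :: "real \<Rightarrow> real \<Rightarrow> real \<Rightarrow> real \<times> real" where
  "b_plus rh b tb = right_wedge rh tb b"

(* The time coordinate is reversed on the left. *)
definition b_minus :: "real \<Rightarrow> real \<Rightarrow> real \<Rightarrow> real \<times> real" where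
  "b_minus rh b tb = left_wedge rh (- tb) b"

(* Matter entropy per unit area without island, for the two-dimensional CFT of central
   charge c and radiation regions bounded by the points p and q.
   The power of rh makes the argument of the logarithm dimensionless. *)
definition matter_entropy ::
  "real \<Rightarrow> real \<Rightarrow> conformal_metric \<Rightarrow> real \<times> real \<Rightarrow> real \<times> real \<Rightarrow> real" where
  "matter_entropy c rh g p q =
     c / 12 * ln ((fst q - fst p)\<^sup>2 * (snd q - snd p)\<^sup>2
                  * exp (2 * rho g p) * exp (2 * rho g q) / rh ^ 4)"

lemma line_element_linear_dilaton_bh:
  "line_element (linear_dilaton_bh rh) (u, v) du dv dx dy =
     - du * dv + (sqrt (rh\<^sup>2 - u * v))\<^sup>2 * (dx\<^sup>2 + dy\<^sup>2)"
  by (simp add: line_element_def linear_dilaton_bh_def)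

lemma wedge_radius:
  assumes "rh > 0" "r > rh"
  shows "radius (linear_dilaton_bh rh) (right_wedge rh t r) = r"
    and "radius (linear_dilaton_bh rh) (left_wedge rh t r) = r"
proof -
  have "r\<^sup>2 > rh\<^sup>2" using assms by (simp add: power_strict_mono)
  then have pos: "r\<^sup>2 / rh\<^sup>2 - 1 > 0" using assms by (simp add: field_simps)
  have "exp (- (t - tortoise rh r) / rh) * exp ((t + tortoise rh r) / rh)
        = exp (ln (r\<^sup>2 / rh\<^sup>2 - 1))"
    unfolding exp_add[symmetric] tortoise_def using assms by (simp add: field_simps)
  also have "\<dots> = r\<^sup>2 / rh\<^sup>2 - 1" using pos by simp
  finally have e: "exp (- (t - tortoise rh r) / rh) * exp ((t + tortoise rh r) / rh)
        = r\<^sup>2 / rh\<^sup>2 - 1" .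
  have "rh\<^sup>2 + rh\<^sup>2 * (exp (- (t - tortoise rh r) / rh) * exp ((t + tortoise rh r) / rh)) = r\<^sup>2"
    unfolding e using assms by (simp add: field_simps)
  then have "sqrt (rh\<^sup>2 + rh\<^sup>2 * (exp (- (t - tortoise rh r) / rh) * exp ((t + tortoise rh r) / rh))) = r"
    using assms by simp
  then show "radius (linear_dilaton_bh rh) (right_wedge rh t r) = r"
    and "radius (linear_dilaton_bh rh) (left_wedge rh t r) = r"
    by (simp_all add: linear_dilaton_bh_def right_wedge_def left_wedge_def
        power2_eq_square mult_ac)
qed

end

theory Submission
  imports Defs "HOL-Real_Asymp.Real_Asymp"
begin

text \<open>Both coordinate gaps between \<open>b_minus\<close> and \<open>b_plus\<close> equal, up
  to sign, \<open>rh * L\<close> with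
  \<open>L = 2 * exp (tortoise rh b / rh) * cosh (tb / rh)\<close>. Since \<open>rho\<close>
  vanishes, the argument of the logarithm is \<open>L ^ 4\<close>, which turns \<open>c / 12\<close>
  into \<open>c / 3\<close>. The factor 1/2 in \<open>tortoise\<close> makes its exponential a
  square root (\<open>exp_tortoise\<close>). Linear growth is that of the logarithm of cosh
  (\<open>ln_cosh_asymp_equiv\<close>).\<close>

lemma exp_tortoise:
  assumes "rh > 0" and "r > rh"
  shows "exp (tortoise rh r / rh) = sqrt ((r\<^sup>2 - rh\<^sup>2) / rh\<^sup>2)"
proof -
  have "r\<^sup>2 > rh\<^sup>2"
    using assms by (simp add: power_strict_mono)
  then have pos: "r\<^sup>2 / rh\<^sup>2 - 1 > 0"
    using assms by (simp add: field_simps)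
  have "exp (tortoise rh r / rh) = exp (ln (r\<^sup>2 / rh\<^sup>2 - 1) / 2)"
    using assms by (simp add: tortoise_def)
  also have "\<dots> = sqrt (r\<^sup>2 / rh\<^sup>2 - 1)"
    using pos by (simp flip: ln_sqrt)
  also have "r\<^sup>2 / rh\<^sup>2 - 1 = (r\<^sup>2 - rh\<^sup>2) / rh\<^sup>2"
    using assms by (simp add: field_simps)
  finally show ?thesis .
qed

text \<open>Reversing time on the left pairs \<open>exp (tb / rh)\<close> with
  \<open>exp (- (tb / rh))\<close> in each null coordinate; the opposite signs of the wedges make
  the difference add them up to a cosh.\<close>

lemma
  fixes rh b tb :: real
  shows fst_b_minus_diff_b_plus:
      "fst (b_minus rh b tb) - fst (b_plus rh b tb)
        = rh * (2 * exp (tortoise rh b / rh) * cosh (tb / rh))"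
    and snd_b_minus_diff_b_plus:
      "snd (b_minus rh b tb) - snd (b_plus rh b tb)
        = - rh * (2 * exp (tortoise rh b / rh) * cosh (tb / rh))"
proof -
  \<comment> \<open>In this form \<open>exp_add\<close> splits off the common factor
    \<open>exp (tortoise rh b / rh)\<close>, leaving the two halves of
    \<open>cosh_def\<close>.\<close>
  have exponents: "- (t - s) / rh = s / rh + - (t / rh)" "(t + s) / rh = s / rh + t / rh" for s t
    by (simp_all add: add_divide_distrib diff_divide_distrib)
  show "fst (b_minus rh b tb) - fst (b_plus rh b tb)
      = rh * (2 * exp (tortoise rh b / rh) * cosh (tb / rh))"
    and "snd (b_minus rh b tb) - snd (b_plus rh b tb)
      = - rh * (2 * exp (tortoise rh b / rh) * cosh (tb / rh))"
    unfolding b_plus_def b_minus_def right_wedge_def left_wedge_def exponents exp_add cosh_def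
    by (simp_all add: algebra_simps)
qed

lemma matter_entropy_linear_dilaton_bh:
  fixes c rh b tb :: real
  assumes "rh > 0" and "b > rh"
  shows "matter_entropy c rh (linear_dilaton_bh rh) (b_plus rh b tb) (b_minus rh b tb)
    = c / 3 * ln (2 * sqrt ((b\<^sup>2 - rh\<^sup>2) / rh\<^sup>2) * cosh (tb / rh))"
proof -
  define L where "L = 2 * exp (tortoise rh b / rh) * cosh (tb / rh)"
  have "L > 0"
    by (simp add: L_def cosh_real_pos)
  have "matter_entropy c rh (linear_dilaton_bh rh) (b_plus rh b tb) (b_minus rh b tb)
      = c / 12 * ln ((rh * L)\<^sup>2 * (- rh * L)\<^sup>2 / rh ^ 4)"
    unfolding matter_entropy_def fst_b_minus_diff_b_plus snd_b_minus_diff_b_plus L_def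
    by (simp add: linear_dilaton_bh_def)
  also have "(rh * L)\<^sup>2 * (- rh * L)\<^sup>2 / rh ^ 4 = L ^ 4"
    using assms by (simp add: field_simps eval_nat_numeral)
  also have "c / 12 * ln (L ^ 4) = c / 3 * ln L"
    using \<open>L > 0\<close> by (simp add: ln_realpow)
  finally show ?thesis
    by (simp only: L_def exp_tortoise[OF assms])
qed

text \<open>As cosh x = exp x * (1 + exp (-2 x)) / 2, the logarithm is \<open>t / rh\<close> plus a
  bounded term, so the prefactor \<open>a\<close> does not affect the leading order.\<close>

lemma ln_cosh_asymp_equiv:
  fixes a k rh :: real
  assumes "a > 0" and "k > 0" and "rh > 0"
  shows "(\<lambda>t. k * ln (a * cosh (t / rh))) \<sim>[at_top] (\<lambda>t. k * (t / rh))"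
  using assms by real_asymp

theorem mainTheorem5:
  fixes c rh b :: real
  assumes "c > 0" and "rh > 0" and "b > rh"
  shows "(\<forall>tb\<ge>0. matter_entropy c rh (linear_dilaton_bh rh) (b_plus rh b tb) (b_minus rh b tb)
            = c / 3 * ln (2 * sqrt ((b\<^sup>2 - rh\<^sup>2) / rh\<^sup>2) * cosh (tb / rh)))
       \<and> asymp_equiv
            (\<lambda>tb. matter_entropy c rh (linear_dilaton_bh rh) (b_plus rh b tb) (b_minus rh b tb))
            at_top (\<lambda>tb. c / 3 * (tb / rh))"
proof -
  \<comment> \<open>The root is positive because, read backwards, \<open>exp_tortoise\<close> makes
    it an exponential.\<close>
  have "2 * sqrt ((b\<^sup>2 - rh\<^sup>2) / rh\<^sup>2) > 0"
    using assms by (simp flip: exp_tortoise)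
  then show ?thesis
    unfolding matter_entropy_linear_dilaton_bh[OF assms(2,3)]
    using assms ln_cosh_asymp_equiv[of _ "c / 3" rh] by simp
qed

end
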